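(* Fix $p\in(0,1)$ and let $G_{n,p}$ be the Erdős–Rényi random graph on $n$ vertices (each possible edge present independently with probability $p$). Let $x_1\ge\cdots\ge x_n$ be the roots of the matching polynomial $m(G_{n,p},x)$, $\lambda_i=x_i/\sqrt{np}$, and $F_n(x)=\frac1n|\{i:\lambda_i\le x\}|$. Then for every positive integer $k$, $$\lim_{n\to\infty}\mathbf{E}\int_{\mathbb{R}}x^k\,dF_n(x)=\int_{\mathbb{R}}x^k\,dF_{sc}(x),$$ where $F_{sc}$ is the standard semicircle distribution with density $\rho_{sc}(x)=\frac{1}{2\pi}\sqrt{4-x^2}$ on $|x|\le 2$ (and $0$ elsewhere).
   Context: For a finite simple graph $G$ of order $n$, let $m_k(G)$ be the number of $k$-matchings of $G$, with $m_0(G)=1$. The matching polynomial is $m(G,x)=\sum_{k=0}^{\lfloor n/2\rfloor}(-1)^k m_k(G)x^{n-2k}$; all its roots are real. Note $\int x^k dF_n(x)=\frac1n\sum_i\lambda_i^k$. *)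

theory Defs
  imports
    "HOL-Probability.Probability"
    "HOL-Computational_Algebra.Computational_Algebra"
begin

text \<open>A finite simple graph is given by a finite vertex set \<open>V\<close> and an edge set
  \<open>E \<subseteq> all_edges V\<close>.\<close>

definition all_edges :: "'a set \<Rightarrow> 'a set set" where
  "all_edges V = {e. e \<subseteq> V \<and> card e = 2}"

definition matchings :: "'a set set \<Rightarrow> nat \<Rightarrow> 'a set set set" where
  "matchings E k = {M. M \<subseteq> E \<and> disjoint M \<and> card M = k}"

definition matching_poly :: "'a set \<Rightarrow> 'a set set \<Rightarrow> real poly" where
  "matching_poly V E =
     (\<Sum>k = 0..card V div 2. monom ((-1) ^ k * real (card (matchings E k))) (card V - 2 * k))"

definition erdos_renyi :: "nat \<Rightarrow> real \<Rightarrow> nat set set pmf" where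
  "erdos_renyi n p =
     map_pmf (\<lambda>f. {e \<in> all_edges {1..n}. f e})
       (Pi_pmf (all_edges {1..n}) False (\<lambda>_. bernoulli_pmf p))"

text \<open>The roots are listed with multiplicity and in decreasing order, so that the \<open>i\<close>-th root,
  counted from 1, sits at list position \<open>i - 1\<close>. By real-rootedness of the matching polynomial,
  the list has length \<open>n\<close>.\<close>

definition matching_root :: "nat \<Rightarrow> nat set set \<Rightarrow> nat \<Rightarrow> real" where
  "matching_root n E i =
     rev (sorted_list_of_multiset (proots (matching_poly {1..n} E))) ! (i - 1)"

definition scaled_root :: "nat \<Rightarrow> real \<Rightarrow> nat set set \<Rightarrow> nat \<Rightarrow> real" where
  "scaled_root n p E i = matching_root n E i / sqrt (real n * p)"

definition root_distribution :: "nat \<Rightarrow> real \<Rightarrow> nat set set \<Rightarrow> real \<Rightarrow> real" where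
  "root_distribution n p E x = real (card {i \<in> {1..n}. scaled_root n p E i \<le> x}) / real n"

definition semicircle_density :: "real \<Rightarrow> real" where
  "semicircle_density x = (if \<bar>x\<bar> \<le> 2 then 1 / (2 * pi) * sqrt (4 - x\<^sup>2) else 0)"

definition semicircle_distribution :: "real \<Rightarrow> real" where
  "semicircle_distribution x = (LINT t:{..x}|lborel. semicircle_density t)"

text \<open>The integral of \<open>f\<close> with respect to \<open>dF\<close>, for a right-continuous nondecreasing \<open>F\<close>.\<close>

definition stieltjes_integral :: "(real \<Rightarrow> real) \<Rightarrow> (real \<Rightarrow> real) \<Rightarrow> real" where
  "stieltjes_integral F f = (LINT x|interval_measure F. f x)"

end

theory Submission
  imports Defs "HOL-Real_Asymp.Real_Asymp"
begin

text \<open>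
  Let \<open>Q\<^sub>E(X)\<close> be the matching polynomial with its coefficients reversed, that is
  \<open>\<Prod>(1 - x\<^sub>i X)\<close>. Then \<open>- X Q\<^sub>E' / Q\<^sub>E\<close> generates the power sums of the roots, and by the two
  vertex-deletion formulas for matchings the \<open>k\<close>-th power sum is the sum over all vertices \<open>v\<close> of the
  coefficient of \<open>X\<^sup>k\<close> in \<open>W\<^sub>E\<^sub>,\<^sub>v = Q\<^sub>E\<^sub>-\<^sub>v / Q\<^sub>E\<close>, where
  \<open>W\<^sub>E\<^sub>,\<^sub>v = 1 + X\<^sup>2 \<Sum>\<^sub>u\<^sub>~\<^sub>v W\<^sub>E\<^sub>-\<^sub>v\<^sub>,\<^sub>u W\<^sub>E\<^sub>,\<^sub>v\<close> (the generating function of closed tree-like walks).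
  The moments \<open>c\<^sub>k\<close> of the semicircle law satisfy the same recurrence with the sum over neighbours
  dropped, so the coefficient of \<open>X\<^sup>k\<close> lies between \<open>c\<^sub>k (\<delta> - k)\<^bsup>k/2\<^esup>\<close> and \<open>c\<^sub>k \<Delta>\<^bsup>k/2\<^esup>\<close>, where \<open>\<delta>\<close> and
  \<open>\<Delta>\<close> are the minimal and maximal degree. By Hoeffding's inequality and a union bound, all degrees
  are within \<open>n\<^bsup>3/4\<^esup>\<close> of \<open>n p\<close> with probability tending to 1; on the exceptional event the moments
  are bounded uniformly in \<open>n\<close>.
\<close>

unbundle no vec_syntax

subsection \<open>Matchings and vertex deletion\<close>

text \<open>Matchings do not see isolated vertices, so a graph is carried by its edge set alone and
  the deleted vertex need not be removed from anything else.\<close>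

definition delete_vertex :: "'a set set \<Rightarrow> 'a \<Rightarrow> 'a set set" where
  "delete_vertex E v = {e \<in> E. v \<notin> e}"

definition neighbours :: "'a set set \<Rightarrow> 'a \<Rightarrow> 'a set" where
  "neighbours E v = {u. {u, v} \<in> E}"

definition all_matchings :: "'a set set \<Rightarrow> 'a set set set" where
  "all_matchings E = {M. M \<subseteq> E \<and> disjoint M}"

text \<open>The ring is left general: the recurrence is used at \<open>- 1 / z\<^sup>2\<close> over
  the complex numbers to locate roots, and at \<open>- (fps_X\<^sup>2)\<close> over power series to
  obtain power sums.\<close>

definition matching_sum :: "'a set set \<Rightarrow> 'b::comm_ring_1 \<Rightarrow> 'b" where
  "matching_sum E y = (\<Sum>M\<in>all_matchings E. y ^ card M)"

lemma finite_all_edges: "finite V \<Longrightarrow> finite (all_edges V)"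
  by (rule finite_subset[of _ "Pow V"]) (auto simp: all_edges_def)

lemma finite_edge_set: "finite V \<Longrightarrow> E \<subseteq> all_edges V \<Longrightarrow> finite E"
  by (meson finite_all_edges finite_subset)

lemma finite_all_matchings: "finite E \<Longrightarrow> finite (all_matchings E)"
  by (rule finite_subset[of _ "Pow E"]) (auto simp: all_matchings_def)

lemma delete_vertex_subset: "delete_vertex E v \<subseteq> E"
  by (auto simp: delete_vertex_def)

lemma delete_vertex_all_edges:
  "E \<subseteq> all_edges V \<Longrightarrow> delete_vertex E v \<subseteq> all_edges (V - {v})"
  by (auto simp: delete_vertex_def all_edges_def)

lemma neighbours_subset: "E \<subseteq> all_edges V \<Longrightarrow> neighbours E v \<subseteq> V - {v}"
  by (fastforce simp: neighbours_def all_edges_def card_insert_if split: if_splits)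

lemma finite_neighbours: "finite V \<Longrightarrow> E \<subseteq> all_edges V \<Longrightarrow> finite (neighbours E v)"
  by (meson finite_Diff finite_subset neighbours_subset)

lemma card_2_other:
  assumes "card e = 2" "v \<in> e"
  shows "\<exists>u. u \<noteq> v \<and> e = {u, v}"
  using assms by (auto simp: card_2_iff)

lemma matchings_avoiding:
  "{M \<in> all_matchings E. v \<notin> \<Union>M} = all_matchings (delete_vertex E v)"
  by (auto simp: all_matchings_def delete_vertex_def)

lemma insert_edge_matching:
  assumes "E \<subseteq> all_edges V" "u \<in> neighbours E v"
    and "M \<in> all_matchings (delete_vertex (delete_vertex E v) u)"
  shows "insert {u, v} M \<in> all_matchings E" "{u, v} \<notin> M"
  using assms
  by (auto simp: all_matchings_def delete_vertex_def neighbours_def disjoint_def)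

text \<open>A matching has exactly one edge at a covered vertex, and its other edges avoid both ends
  of that edge.\<close>

lemma matchings_covering:
  assumes "E \<subseteq> all_edges V"
  shows "{M \<in> all_matchings E. v \<in> \<Union>M} =
    (\<Union>u\<in>neighbours E v. insert {u, v} ` all_matchings (delete_vertex (delete_vertex E v) u))"
    (is "?L = ?R")
proof
  show "?R \<subseteq> ?L"
    using insert_edge_matching[OF assms] by auto
  show "?L \<subseteq> ?R"
  proof
    fix M assume "M \<in> ?L"
    then obtain e where M: "M \<subseteq> E" "disjoint M" "e \<in> M" "v \<in> e"
      by (auto simp: all_matchings_def)
    then have "card e = 2"
      using assms by (auto simp: all_edges_def)
    then obtain u where u: "u \<noteq> v" "e = {u, v}"
      using card_2_other M by metis
    have "f \<inter> e = {}" if "f \<in> M - {e}" for f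
      using M that by (auto simp: disjoint_def)
    then have "M - {e} \<in> all_matchings (delete_vertex (delete_vertex E v) u)"
      using M u by (auto simp: all_matchings_def delete_vertex_def disjoint_def)
    moreover have "u \<in> neighbours E v" "M = insert {u, v} (M - {e})"
      using M u by (auto simp: neighbours_def)
    ultimately show "M \<in> ?R" by blast
  qed
qed

text \<open>Matchings are split by whether they cover \<open>v\<close>; if they do, the edge at
  \<open>v\<close> contributes the factor \<open>y\<close>.\<close>

lemma matching_sum_recurrence:
  fixes y :: "'b::comm_ring_1"
  assumes V: "finite V" and E: "E \<subseteq> all_edges V"
  shows "matching_sum E y = matching_sum (delete_vertex E v) y +
    y * (\<Sum>u\<in>neighbours E v. matching_sum (delete_vertex (delete_vertex E v) u) y)"
proof -
  let ?D = "\<lambda>u. all_matchings (delete_vertex (delete_vertex E v) u)"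
  have finE: "finite E" by (rule finite_edge_set[OF V E])
  have finD: "finite (?D u)" for u
    by (intro finite_all_matchings finite_subset[OF _ finE]) (auto simp: delete_vertex_def)
  have "matching_sum E y = (\<Sum>M | M \<in> all_matchings E \<and> v \<notin> \<Union>M. y ^ card M) +
      (\<Sum>M | M \<in> all_matchings E \<and> v \<in> \<Union>M. y ^ card M)"
    using sum.Int_Diff[OF finite_all_matchings[OF finE], of "\<lambda>M. y ^ card M" "{M. v \<notin> \<Union>M}"]
    unfolding matching_sum_def Collect_conj_eq Diff_eq Collect_neg_eq[symmetric] Collect_mem_eq
      not_not .
  also have "(\<Sum>M | M \<in> all_matchings E \<and> v \<in> \<Union>M. y ^ card M) =
      (\<Sum>u\<in>neighbours E v. \<Sum>M\<in>insert {u, v} ` ?D u. y ^ card M)"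
    unfolding matchings_covering[OF E]
  proof (rule sum.UNION_disjoint)
    show "\<forall>u\<in>neighbours E v. \<forall>w\<in>neighbours E v. u \<noteq> w \<longrightarrow>
        insert {u, v} ` ?D u \<inter> insert {w, v} ` ?D w = {}"
    proof (intro ballI impI)
      fix u w assume "u \<in> neighbours E v" "w \<in> neighbours E v" "u \<noteq> w"
      \<comment> \<open>\<open>N\<close> avoids \<open>v\<close>, so the only edge at
        \<open>v\<close> in \<open>insert {w, v} N\<close> is \<open>{w, v}\<close>, which forces
        \<open>u = w\<close>.\<close>
      have False if "insert {u, v} M = insert {w, v} N" "M \<in> ?D u" "N \<in> ?D w" for M N
      proof -
        have "{u, v} \<in> insert {w, v} N" using that by auto
        then show False
          using that \<open>u \<noteq> w\<close> by (auto simp: all_matchings_def delete_vertex_def doubleton_eq_iff)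
      qed
      then show "insert {u, v} ` ?D u \<inter> insert {w, v} ` ?D w = {}" by blast
    qed
  qed (auto simp: finD finite_neighbours[OF V E])
  also have "\<dots> = (\<Sum>u\<in>neighbours E v. \<Sum>M\<in>?D u. y * y ^ card M)"
  proof (rule sum.cong[OF refl])
    fix u assume u: "u \<in> neighbours E v"
    note not_in = insert_edge_matching(2)[OF E u]
    have "inj_on (insert {u, v}) (?D u)"
      by (rule inj_onI) (metis insert_ident not_in)
    then have "(\<Sum>M\<in>insert {u, v} ` ?D u. y ^ card M) = (\<Sum>M\<in>?D u. y ^ card (insert {u, v} M))"
      by (simp add: sum.reindex)
    also have "\<dots> = (\<Sum>M\<in>?D u. y * y ^ card M)"
    proof (rule sum.cong[OF refl])
      fix M assume M: "M \<in> ?D u"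
      then have "finite M"
        by (auto simp: all_matchings_def delete_vertex_def intro: finite_subset[OF _ finE])
      then show "y ^ card (insert {u, v} M) = y * y ^ card M"
        using not_in[OF M] by simp
    qed
    finally show "(\<Sum>M\<in>insert {u, v} ` ?D u. y ^ card M) = (\<Sum>M\<in>?D u. y * y ^ card M)" .
  qed
  finally show ?thesis
    unfolding matchings_avoiding by (simp add: matching_sum_def sum_distrib_left)
qed

lemma card_Union_matching:
  assumes E: "E \<subseteq> all_edges V" and V: "finite V" and M: "M \<in> all_matchings E"
  shows "card (\<Union>M) = 2 * card M" "\<Union>M \<subseteq> V"
proof -
  have c: "card e = 2 \<and> e \<subseteq> V" if "e \<in> M" for e
    using that M E by (auto simp: all_matchings_def all_edges_def)
  have "card (\<Union>M) = sum card M"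
  proof (rule card_Union_disjoint)
    show "pairwise disjnt M"
      using M by (simp add: all_matchings_def disjoint_def pairwise_def disjnt_def)
    show "finite e" if "e \<in> M" for e
      using c[OF that] V finite_subset by blast
  qed
  then show "card (\<Union>M) = 2 * card M" using c by simp
  show "\<Union>M \<subseteq> V" using c by auto
qed

lemma card_matching_le:
  assumes "E \<subseteq> all_edges V" "finite V" "M \<in> all_matchings E"
  shows "2 * card M \<le> card V"
  using card_Union_matching[OF assms] card_mono[OF assms(2)] by metis

text \<open>Double counting of the pairs of a matching and a vertex that it misses. For matching
  polynomials this says that the derivative of m(G, x) is the sum of all m(G - v, x).\<close>

lemma sum_matching_sum_delete_vertex:
  fixes y :: "'b::comm_ring_1"
  assumes V: "finite V" and E: "E \<subseteq> all_edges V"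
  shows "(\<Sum>v\<in>V. matching_sum (delete_vertex E v) y) =
    (\<Sum>M\<in>all_matchings E. of_nat (card V - 2 * card M) * y ^ card M)"
proof -
  have fin: "finite (all_matchings E)"
    by (intro finite_all_matchings finite_edge_set[OF V E])
  have "(\<Sum>v\<in>V. matching_sum (delete_vertex E v) y) =
      (\<Sum>v\<in>V. \<Sum>M | M \<in> all_matchings E \<and> v \<notin> \<Union>M. y ^ card M)"
    unfolding matching_sum_def matchings_avoiding[symmetric] ..
  also have "\<dots> = (\<Sum>M\<in>all_matchings E. \<Sum>v | v \<in> V \<and> v \<notin> \<Union>M. y ^ card M)"
    by (rule sum.swap_restrict[OF V fin])
  also have "\<dots> = (\<Sum>M\<in>all_matchings E. of_nat (card V - 2 * card M) * y ^ card M)"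
  proof (rule sum.cong[OF refl])
    fix M assume M: "M \<in> all_matchings E"
    have "{v. v \<in> V \<and> v \<notin> \<Union>M} = V - \<Union>M" by auto
    moreover have "card (V - \<Union>M) = card V - 2 * card M"
      using card_Union_matching[OF E V M] by (metis V card_Diff_subset finite_subset)
    ultimately show "(\<Sum>v | v \<in> V \<and> v \<notin> \<Union>M. y ^ card M) =
        of_nat (card V - 2 * card M) * y ^ card M" by simp
  qed
  finally show ?thesis .
qed

lemma matching_sum_by_size:
  fixes y :: "'b::comm_ring_1"
  assumes V: "finite V" and E: "E \<subseteq> all_edges V"
  shows "matching_sum E y = (\<Sum>k = 0..card V div 2. of_nat (card (matchings E k)) * y ^ k)"
proof -
  have fin: "finite (all_matchings E)"
    by (intro finite_all_matchings finite_edge_set[OF V E])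
  have "matching_sum E y =
      (\<Sum>k = 0..card V div 2. \<Sum>M | M \<in> all_matchings E \<and> card M = k. y ^ card M)"
    unfolding matching_sum_def
  proof (rule sum.group[symmetric, OF fin])
    show "card ` all_matchings E \<subseteq> {0..card V div 2}"
      using card_matching_le[OF E V] by (force simp: less_eq_div_iff_mult_less_eq)
  qed simp
  also have "\<dots> = (\<Sum>k = 0..card V div 2. of_nat (card (matchings E k)) * y ^ k)"
  proof (rule sum.cong[OF refl])
    fix k
    have "(\<Sum>M | M \<in> all_matchings E \<and> card M = k. y ^ card M) =
        (\<Sum>M | M \<in> all_matchings E \<and> card M = k. y ^ k)"
      by (rule sum.cong) auto
    then show "(\<Sum>M | M \<in> all_matchings E \<and> card M = k. y ^ card M) =
        of_nat (card (matchings E k)) * y ^ k"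
      by (simp add: all_matchings_def matchings_def conj_assoc)
  qed
  finally show ?thesis .
qed

lemma matching_sum_0:
  assumes "finite E"
  shows "matching_sum E (0::'b::comm_ring_1) = 1"
proof -
  have "matching_sum E (0::'b) = (\<Sum>M\<in>all_matchings E. if M = {} then 1 else 0)"
    unfolding matching_sum_def
    using assms
    by (intro sum.cong) (auto simp: all_matchings_def power_0_left card_eq_0_iff dest: finite_subset)
  also have "\<dots> = 1"
    using assms by (simp add: finite_all_matchings) (simp add: all_matchings_def disjoint_def)
  finally show ?thesis .
qed

subsection \<open>Real-rootedness\<close>

text \<open>With \<open>g(E, v) = m(E, z) / m(E - v, z)\<close> the vertex recurrence reads
  \<open>g(E, v) = z - \<Sum>\<^sub>u\<^sub>~\<^sub>v 1 / g(E - v, u)\<close>, which preserves the open upper half-plane.\<close>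

lemma Im_matching_sum_ratio_pos:
  assumes "finite V" "E \<subseteq> all_edges V" "Im z > 0"
  shows "matching_sum E (- 1 / z\<^sup>2) \<noteq> 0 \<and>
    (\<forall>v\<in>V. Im (z * matching_sum E (- 1 / z\<^sup>2) / matching_sum (delete_vertex E v) (- 1 / z\<^sup>2)) > 0)"
  using assms(1,2)
proof (induction "card V" arbitrary: V E rule: less_induct)
  case less
  let ?q = "\<lambda>E. matching_sum E (- 1 / z\<^sup>2)"
  have z: "z \<noteq> 0" using assms(3) by auto
  have pos: "Im (z * ?q E / ?q (delete_vertex E v)) > 0" if v: "v \<in> V" for v
  proof -
    define D where "D = delete_vertex E v"
    have D: "D \<subseteq> all_edges (V - {v})"
      unfolding D_def by (rule delete_vertex_all_edges[OF less.prems(2)])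
    have "card (V - {v}) < card V"
      using v less.prems(1) by (intro card_Diff1_less)
    note step = less.hyps[OF this finite_Diff[OF less.prems(1)] D]
    then have qD: "?q D \<noteq> 0" ..
    have IH: "Im (z * ?q D / ?q (delete_vertex D u)) > 0" if "u \<in> V - {v}" for u
      using step that by blast
    \<comment> \<open>The degrees of the matching polynomials of the graph and of the graph without
      \<open>v\<close> differ by one, so a single factor \<open>z\<close> survives in their
      quotient.\<close>
    have "z * ?q E / ?q D = z - (\<Sum>u\<in>neighbours E v. ?q (delete_vertex D u)) / (z * ?q D)"
      unfolding matching_sum_recurrence[OF less.prems, of _ v] D_def[symmetric]
      using z qD by (simp add: field_simps power2_eq_square)
    also have "\<dots> = z - (\<Sum>u\<in>neighbours E v. inverse (z * ?q D / ?q (delete_vertex D u)))"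
      by (simp add: sum_divide_distrib)
    finally have "Im (z * ?q E / ?q D) =
        Im z - (\<Sum>u\<in>neighbours E v. Im (inverse (z * ?q D / ?q (delete_vertex D u))))"
      by simp
    \<comment> \<open>Inversion swaps the upper and lower half-planes, so subtracting the inverses
      can only raise the imaginary part.\<close>
    moreover have "Im (inverse w) \<le> 0" if "Im w > 0" for w
      using that by (simp add: divide_nonpos_nonneg)
    then have "(\<Sum>u\<in>neighbours E v. Im (inverse (z * ?q D / ?q (delete_vertex D u)))) \<le> 0"
      using neighbours_subset[OF less.prems(2), of v] IH by (intro sum_nonpos) blast
    ultimately show ?thesis using assms(3) by (simp add: D_def)
  qed
  \<comment> \<open>A zero would make the ratio at any vertex vanish, against its positive imaginary
    part; the empty graph has no such vertex and is treated directly.\<close>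
  have "?q E \<noteq> 0"
  proof (cases "V = {}")
    case True
    then have "E = {}" using less.prems by (auto simp: all_edges_def)
    then show ?thesis by (simp add: matching_sum_def all_matchings_def disjoint_def)
  next
    case False
    then show ?thesis using pos by fastforce
  qed
  with pos show ?case by blast
qed

lemma map_poly_of_real_sum:
  "map_poly (of_real :: real \<Rightarrow> 'b::{real_algebra_1,comm_ring_1}) (sum f S) =
    (\<Sum>x\<in>S. map_poly of_real (f x))"
  by (rule poly_eqI) (simp add: coeff_map_poly coeff_sum)

text \<open>Each monomial \<open>z ^ (n - 2 * k)\<close> is \<open>z ^ n\<close> times the
  \<open>k\<close>-th power of \<open>1 / z\<^sup>2\<close>. The complex instance serves
  real-rootedness, the real one the factorization of the reversed polynomial.\<close>

lemma poly_matching_poly: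
  fixes z :: "'b::real_field"
  assumes V: "finite V" and E: "E \<subseteq> all_edges V" and z: "z \<noteq> 0"
  shows "poly (map_poly of_real (matching_poly V E)) z = z ^ card V * matching_sum E (- 1 / z\<^sup>2)"
proof -
  have "poly (map_poly of_real (matching_poly V E)) z =
      (\<Sum>k = 0..card V div 2. (-1) ^ k * of_nat (card (matchings E k)) * z ^ (card V - 2 * k))"
    by (simp add: matching_poly_def map_poly_of_real_sum map_poly_monom poly_sum poly_monom)
  also have "\<dots> = z ^ card V * matching_sum E (- 1 / z\<^sup>2)"
    unfolding matching_sum_by_size[OF V E] sum_distrib_left
  proof (rule sum.cong[OF refl])
    fix k assume "k \<in> {0..card V div 2}"
    then have "z ^ card V = z ^ (card V - 2 * k) * (z\<^sup>2) ^ k"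
      by (simp flip: power_mult power_add)
    then show "(-1) ^ k * of_nat (card (matchings E k)) * z ^ (card V - 2 * k) =
        z ^ card V * (of_nat (card (matchings E k)) * (- 1 / z\<^sup>2) ^ k)"
      using z by (simp add: power_divide power_minus[of "1 / _"] power_minus[of "_ ^ _"] field_simps)
  qed
  finally show ?thesis .
qed


lemma lead_coeff_matching_poly:
  assumes "finite V" "E \<subseteq> all_edges V"
  shows "degree (matching_poly V E) = card V" "lead_coeff (matching_poly V E) = 1"
proof -
  have "finite E" using assms finite_edge_set by blast
  then have "matchings E 0 = {{}}"
    by (auto simp: matchings_def disjoint_def card_eq_0_iff dest: finite_subset)
  then have *: "coeff (matching_poly V E) j = (if j = card V then 1 else 0)" if "j \<ge> card V" for j
  proof -
    have "coeff (matching_poly V E) j = (\<Sum>k = 0..card V div 2. if k = 0 \<and> j = card V then 1 else 0)"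
      unfolding matching_poly_def coeff_sum
      by (rule sum.cong) (use that \<open>matchings E 0 = {{}}\<close> in \<open>auto simp: coeff_monom\<close>)
    also have "\<dots> = (if j = card V then 1 else 0)" by simp
    finally show ?thesis .
  qed
  then show "degree (matching_poly V E) = card V"
    by (intro antisym degree_le le_degree) auto
  with * show "lead_coeff (matching_poly V E) = 1" by simp
qed

lemma matching_poly_real_rooted:
  assumes "finite V" "E \<subseteq> all_edges V" "poly (map_poly complex_of_real (matching_poly V E)) z = 0"
  shows "Im z = 0"
proof (rule ccontr)
  assume z: "Im z \<noteq> 0"
  \<comment> \<open>Only \<open>z\<^sup>2\<close> enters the matching sum, so a root in the lower
    half-plane can be negated.\<close>
  define w where "w = (if Im z > 0 then z else - z)"
  have "Im w > 0" "w\<^sup>2 = z\<^sup>2" using z by (auto simp: w_def)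
  then have "matching_sum E (- 1 / z\<^sup>2) \<noteq> 0"
    using Im_matching_sum_ratio_pos[OF assms(1,2), of w] by simp
  moreover have "z \<noteq> 0" using z by auto
  ultimately show False
    using assms(3) poly_matching_poly[OF assms(1,2) \<open>z \<noteq> 0\<close>] by simp
qed

text \<open>A complex root exists by the fundamental theorem of algebra and is real by hypothesis;
  after dividing it out, the complex roots of the quotient are still roots of
  \<open>p\<close>.\<close>

lemma real_poly_splits:
  fixes p :: "real poly"
  assumes "lead_coeff p = 1"
    and "\<And>z. poly (map_poly complex_of_real p) z = 0 \<Longrightarrow> Im z = 0"
  shows "\<exists>xs. p = (\<Prod>x\<leftarrow>xs. [:- x, 1:])"
  using assms
proof (induction "degree p" arbitrary: p)
  case 0
  then obtain c where "p = [:c:]" by (metis degree_eq_zeroE)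
  then have "p = 1" using 0 by simp
  then show ?case by (intro exI[of _ "[]"]) simp
next
  case (Suc d)
  let ?c = "map_poly complex_of_real"
  have "degree (?c p) = Suc d" using Suc.hyps by (simp add: degree_map_poly)
  then obtain z where z: "poly (?c p) z = 0"
    using fundamental_theorem_of_algebra[of "?c p"] constant_degree[of "?c p"] by auto
  then have "z = of_real (Re z)" using Suc.prems(2) by (simp add: complex_eq_iff)
  moreover have ev: "poly (?c p) (of_real x) = of_real (poly p x)" for p x
    by (induction p) (simp_all add: map_poly_pCons)
  ultimately have "poly p (Re z) = 0" using z by (metis of_real_eq_0_iff)
  then obtain q where q: "p = [:- Re z, 1:] * q"
    by (metis dvdE poly_eq_0_iff_dvd)
  have cm: "?c p = [:- of_real (Re z), 1:] * ?c q"
    unfolding q by (rule poly_eqI) (simp add: coeff_map_poly coeff_pCons split: nat.split)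
  have "q \<noteq> 0" using Suc.hyps q by auto
  then have "degree p = Suc (degree q)" unfolding q by (subst degree_mult_eq) auto
  moreover have "lead_coeff q = 1" using Suc.prems(1) unfolding q lead_coeff_mult by simp
  moreover have "Im z = 0" if "poly (?c q) z = 0" for z
    using Suc.prems(2) that by (simp add: cm)
  ultimately obtain xs where "q = (\<Prod>x\<leftarrow>xs. [:- x, 1:])"
    using Suc.hyps by (metis Suc_inject)
  then show ?case using q by (intro exI[of _ "Re z # xs"]) simp
qed

lemma proots_prod_list_linear: "proots (\<Prod>x\<leftarrow>xs. [:- x, 1:]) = mset (xs :: real list)"
proof (induction xs)
  case (Cons x xs)
  define P where "P = (\<Prod>x\<leftarrow>xs. [:- x, 1:])"
  have "P \<noteq> 0" by (auto simp: P_def prod_list_zero_iff)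
  then have "proots ([:- x, 1:] * P) = proots [:- x, 1:] + proots P"
    by (intro proots_mult) (simp add: pCons_eq_0_iff)
  also have "\<dots> = mset (x # xs)"
    using Cons by (simp add: P_def)
  finally show ?case unfolding list.map prod_list.Cons P_def .
qed simp

subsection \<open>Power sums of the roots\<close>

definition matching_fps :: "'a set set \<Rightarrow> real fps" where
  "matching_fps E = matching_sum E (- (fps_X\<^sup>2))"

definition walk_fps :: "'a set set \<Rightarrow> 'a \<Rightarrow> real fps" where
  "walk_fps E v = matching_fps (delete_vertex E v) * inverse (matching_fps E)"

lemma matching_fps_nth_0:
  assumes "finite E"
  shows "matching_fps E $ 0 = 1"
proof -
  have "matching_fps E $ 0 = (matching_sum E 0 :: real)"
    by (simp add: matching_fps_def matching_sum_def fps_sum_nth fps_power_zeroth)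
  then show ?thesis by (simp add: matching_sum_0[OF assms])
qed

text \<open>This is the matching recurrence at \<open>- (fps_X\<^sup>2)\<close>, divided by
  \<open>matching_fps E\<close>.\<close>

lemma walk_fps_recurrence:
  assumes V: "finite V" and E: "E \<subseteq> all_edges V"
  shows "walk_fps E v =
    1 + fps_X\<^sup>2 * (\<Sum>u\<in>neighbours E v. walk_fps (delete_vertex E v) u * walk_fps E v)"
proof -
  let ?D = "delete_vertex E v"
  have fin: "finite E" "finite ?D"
    using finite_edge_set[OF V E] finite_subset[OF delete_vertex_subset] by auto
  have inv: "matching_fps E * inverse (matching_fps E) = 1"
    "inverse (matching_fps ?D) * matching_fps ?D = 1"
    using fin by (auto simp: matching_fps_nth_0 inverse_mult_eq_1 inverse_mult_eq_1')
  \<comment> \<open>The product telescopes: \<open>matching_fps ?D\<close> cancels.\<close>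
  have w: "walk_fps ?D u * walk_fps E v =
      matching_fps (delete_vertex ?D u) * inverse (matching_fps E)" for u
    unfolding walk_fps_def using inv(2) by (metis mult.assoc mult_1)
  have "matching_fps E = matching_fps ?D -
      fps_X\<^sup>2 * (\<Sum>u\<in>neighbours E v. matching_fps (delete_vertex ?D u))"
    unfolding matching_fps_def by (subst matching_sum_recurrence[OF V E, of _ v]) simp
  then have "1 = walk_fps E v - fps_X\<^sup>2 *
      (\<Sum>u\<in>neighbours E v. matching_fps (delete_vertex ?D u) * inverse (matching_fps E))"
    using inv(1) unfolding walk_fps_def sum_distrib_right[symmetric]
    by (metis left_diff_distrib mult.assoc)
  then show ?thesis unfolding w by (simp add: algebra_simps)
qed

text \<open>All indices on the right of the third equation are at most \<open>j\<close>, which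
  permits strong induction on the index while the graph varies.\<close>

lemma walk_fps_nth:
  assumes V: "finite V" and E: "E \<subseteq> all_edges V"
  shows "walk_fps E v $ 0 = 1" "walk_fps E v $ 1 = 0"
    "walk_fps E v $ (j + 2) = (\<Sum>u\<in>neighbours E v. \<Sum>i\<le>j.
       walk_fps (delete_vertex E v) u $ i * walk_fps E v $ (j - i))"
proof -
  have w: "walk_fps E v $ k = (if k = 0 then 1 else 0) + (if k < 2 then 0
      else \<Sum>u\<in>neighbours E v. (walk_fps (delete_vertex E v) u * walk_fps E v) $ (k - 2))" for k
    using arg_cong[OF walk_fps_recurrence[OF V E, of v], of "\<lambda>f. f $ k"]
    by (simp add: fps_X_power_mult_nth fps_sum_nth)
  from w[of 0] w[of 1] show "walk_fps E v $ 0 = 1" "walk_fps E v $ 1 = 0" by auto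
  from w[of "j + 2"] show "walk_fps E v $ (j + 2) = (\<Sum>u\<in>neighbours E v. \<Sum>i\<le>j.
       walk_fps (delete_vertex E v) u $ i * walk_fps E v $ (j - i))"
    by (simp add: fps_mult_nth atMost_atLeast0)
qed

text \<open>The operator \<open>fps_X * fps_deriv\<close> is a derivation with eigenvector
  \<open>y\<close>, so eigenvalues add up over products.\<close>

lemma fps_X_mult_deriv_power:
  fixes y :: "'b::comm_ring_1 fps"
  assumes "fps_X * fps_deriv y = 2 * y"
  shows "fps_X * fps_deriv (y ^ k) = of_nat (2 * k) * y ^ k"
proof -
  have "fps_X * fps_deriv (y ^ k) = of_nat k * (fps_X * fps_deriv y) * y ^ (k - 1)"
    unfolding fps_deriv_power' by (simp only: mult_ac)
  also have "\<dots> = of_nat (2 * k) * y ^ k"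
    unfolding assms by (cases k) (simp_all add: algebra_simps)
  finally show ?thesis .
qed

text \<open>Double counting gives each matching the weight \<open>card V - 2 * card M\<close>, and
  the operator \<open>fps_X * fps_deriv\<close> accounts for the part
  \<open>2 * card M\<close>.\<close>

lemma sum_walk_fps:
  assumes V: "finite V" and E: "E \<subseteq> all_edges V"
  shows "(\<Sum>v\<in>V. walk_fps E v) * matching_fps E =
    of_nat (card V) * matching_fps E - fps_X * fps_deriv (matching_fps E)"
proof -
  let ?y = "- (fps_X\<^sup>2) :: real fps"
  have "finite E" by (rule finite_edge_set[OF V E])
  then have "inverse (matching_fps E) * matching_fps E = 1"
    by (simp add: matching_fps_nth_0 inverse_mult_eq_1)
  then have "(\<Sum>v\<in>V. walk_fps E v) * matching_fps E = (\<Sum>v\<in>V. matching_fps (delete_vertex E v))"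
    by (simp add: walk_fps_def sum_distrib_right mult.assoc)
  also have "\<dots> = (\<Sum>M\<in>all_matchings E. of_nat (card V - 2 * card M) * ?y ^ card M)"
    unfolding matching_fps_def by (rule sum_matching_sum_delete_vertex[OF V E])
  also have "\<dots> = (\<Sum>M\<in>all_matchings E. of_nat (card V) * ?y ^ card M -
      fps_X * fps_deriv (?y ^ card M))"
  proof (rule sum.cong[OF refl])
    fix M assume "M \<in> all_matchings E"
    \<comment> \<open>The bound \<open>2 * card M \<le> card V\<close> rules out truncation in the
      natural subtraction.\<close>
    then have "of_nat (card V - 2 * card M) = (of_nat (card V) - of_nat (2 * card M) :: real fps)"
      using card_matching_le[OF E V] by (simp only: of_nat_diff)
    moreover have "fps_X * fps_deriv (?y ^ card M) = of_nat (2 * card M) * ?y ^ card M"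
      by (rule fps_X_mult_deriv_power) (simp add: power2_eq_square)
    ultimately show "of_nat (card V - 2 * card M) * ?y ^ card M =
        of_nat (card V) * ?y ^ card M - fps_X * fps_deriv (?y ^ card M)"
      by (simp only: left_diff_distrib)
  qed
  also have "\<dots> = of_nat (card V) * matching_fps E - fps_X * fps_deriv (matching_fps E)"
    by (simp add: matching_fps_def matching_sum_def sum_subtractf sum_distrib_left fps_deriv_sum)
  finally show ?thesis .
qed

text \<open>Newton's identities as a logarithmic derivative: the geometric series in
  \<open>x\<close> inverts \<open>1 - fps_const x * fps_X\<close>. The equation has the same shape
  as \<open>sum_walk_fps\<close>.\<close>

lemma power_sum_fps:
  fixes xs :: "real list"
  defines "P \<equiv> (\<Prod>x\<leftarrow>xs. 1 - fps_const x * fps_X)"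
  shows "(\<Sum>x\<leftarrow>xs. Abs_fps (\<lambda>k. x ^ k)) * P = of_nat (length xs) * P - fps_X * fps_deriv P"
  unfolding P_def
proof (induction xs)
  case (Cons x xs)
  define P S where "P = (\<Prod>x\<leftarrow>xs. 1 - fps_const x * fps_X)"
    and "S = (\<Sum>x\<leftarrow>xs. Abs_fps (\<lambda>k. x ^ k))"
  define L where "L = 1 - fps_const x * fps_X"
  have G: "Abs_fps (\<lambda>k. x ^ k) * L = 1"
    unfolding L_def
    by (rule fps_ext) (auto simp: algebra_simps fps_X_mult_right_nth simp flip: power_Suc)
  have dL: "fps_X * fps_deriv L = L - 1" by (simp add: L_def)
  have IH: "S * P = of_nat (length xs) * P - fps_X * fps_deriv P"
    using Cons by (simp add: P_def S_def)
  have "(Abs_fps (\<lambda>k. x ^ k) + S) * (L * P) = (Abs_fps (\<lambda>k. x ^ k) * L) * P + L * (S * P)"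
    by (simp add: algebra_simps)
  also have "\<dots> = of_nat (Suc (length xs)) * (L * P) - (L * (fps_X * fps_deriv P) + (fps_X * fps_deriv L) * P)"
    unfolding G IH dL by (simp add: algebra_simps)
  also have "\<dots> = of_nat (Suc (length xs)) * (L * P) - fps_X * fps_deriv (L * P)"
    by (simp add: algebra_simps)
  finally show ?case by (simp add: P_def S_def L_def)
qed simp

text \<open>Replacing the variable by its reciprocal reverses the coefficients and turns a root
  factor into \<open>1 - fps_const x * fps_X\<close>.\<close>

lemma matching_fps_factorization:
  assumes V: "finite V" and E: "E \<subseteq> all_edges V"
    and xs: "matching_poly V E = (\<Prod>x\<leftarrow>xs. [:- x, 1:])" and len: "length xs = card V"
  shows "matching_fps E = (\<Prod>x\<leftarrow>xs. 1 - fps_const x * fps_X)"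
proof -
  have finE: "finite E" by (rule finite_edge_set[OF V E])
  \<comment> \<open>The identity is first proved for polynomial functions, where
    \<open>1 / t\<close> can be substituted; the value at \<open>t = 0\<close> is compared
    separately.\<close>
  have "poly (matching_sum E (- ([:0, 1:]\<^sup>2))) t = poly (\<Prod>x\<leftarrow>xs. [:1, - x:]) t" for t :: real
  proof -
    have L: "poly (matching_sum E (- ([:0, 1:]\<^sup>2))) t = matching_sum E (- (t\<^sup>2))"
      by (simp add: matching_sum_def poly_sum)
    have R: "poly (\<Prod>x\<leftarrow>xs. [:1, - x:]) t = (\<Prod>x\<leftarrow>xs. 1 - t * x)"
      by (induction xs) (auto simp: algebra_simps)
    show ?thesis
    proof (cases "t = 0")
      case True
      have "(\<Prod>x\<leftarrow>xs. 1 - 0 * x) = (1::real)" by (induction xs) auto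
      then show ?thesis unfolding L R using True by (simp add: matching_sum_0[OF finE])
    next
      case False
      have "(1 / t) ^ card V * matching_sum E (- (t\<^sup>2)) = poly (matching_poly V E) (1 / t)"
        using poly_matching_poly[OF V E, of "1 / t"] False by (simp add: power_divide)
      also have "\<dots> = (\<Prod>x\<leftarrow>xs. 1 / t - x)"
        unfolding xs by (induction xs) (auto simp: algebra_simps)
      also have "\<dots> = (1 / t) ^ length xs * (\<Prod>x\<leftarrow>xs. 1 - t * x)"
        using False by (induction xs) (simp_all add: field_simps)
      finally show ?thesis unfolding L R len using False by simp
    qed
  qed
  then have "matching_sum E (- ([:0, 1:]\<^sup>2)) = (\<Prod>x\<leftarrow>xs. [:1, - x:] :: real poly)"
    by (intro poly_eq_poly_eq_iff[THEN iffD1] ext)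
  then have "fps_of_poly (matching_sum E (- ([:0, 1:]\<^sup>2))) = fps_of_poly (\<Prod>x\<leftarrow>xs. [:1, - x:] :: real poly)"
    by simp
  moreover have "fps_of_poly (matching_sum E (- ([:0, 1:]\<^sup>2))) = matching_fps E"
    by (simp add: matching_sum_def matching_fps_def fps_of_poly_sum fps_of_poly_power fps_of_poly_uminus)
  moreover have "fps_of_poly (\<Prod>x\<leftarrow>xs. [:1, - x:]) = (\<Prod>x\<leftarrow>xs. 1 - fps_const x * fps_X)"
    by (simp add: fps_of_poly_prod_list o_def fps_of_poly_linear' flip: fps_const_neg)
  ultimately show ?thesis by simp
qed

text \<open>The power sums and the walk series solve the same equation with the nonzero factor
  \<open>P\<close>, which cancels.\<close>

lemma sum_matching_root_power:
  assumes E: "E \<subseteq> all_edges {1..n}"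
  shows "(\<Sum>i = 1..n. matching_root n E i ^ k) = (\<Sum>v = 1..n. walk_fps E v $ k)"
proof -
  let ?V = "{1..n}"
  have V: "finite ?V" by simp
  obtain xs where xs: "matching_poly ?V E = (\<Prod>x\<leftarrow>xs. [:- x, 1:])"
    using real_poly_splits[OF lead_coeff_matching_poly(2)[OF V E] matching_poly_real_rooted[OF V E]]
    by blast
  have "degree (\<Prod>x\<leftarrow>xs. [:- x, 1:]) = length xs" for xs :: "real list"
  proof (induction xs)
    case (Cons x xs)
    define P where "P = (\<Prod>x\<leftarrow>xs. [:- x, 1:])"
    have "P \<noteq> 0" by (auto simp: P_def prod_list_zero_iff)
    then have "degree ([:- x, 1:] * P) = degree [:- x, 1:] + degree P"
      by (intro degree_mult_eq) simp_all
    also have "\<dots> = length (x # xs)"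
      using Cons by (simp add: P_def)
    finally show ?case unfolding list.map prod_list.Cons P_def .
  qed simp
  then have len: "length xs = card ?V"
    using lead_coeff_matching_poly(1)[OF V E] xs by metis
  define l where "l = rev (sorted_list_of_multiset (proots (matching_poly ?V E)))"
  \<comment> \<open>The sorted list is a permutation of \<open>xs\<close>, so it has
    \<open>n\<close> entries and every position \<open>i - 1\<close> is in range.\<close>
  have l: "mset l = mset xs"
    unfolding l_def xs proots_prod_list_linear by simp
  then have lenl: "length l = n" using len by (metis card_atLeastAtMost diff_Suc_1 size_mset)
  define P where "P = (\<Prod>x\<leftarrow>xs. 1 - fps_const x * fps_X)"
  have PE: "matching_fps E = P"
    unfolding P_def by (rule matching_fps_factorization[OF V E xs len])
  have "P $ 0 = 1"
    using matching_fps_nth_0[OF finite_edge_set[OF V E]] PE by simp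
  then have "P \<noteq> 0" by auto
  moreover have "(\<Sum>x\<leftarrow>xs. Abs_fps (\<lambda>k. x ^ k)) * P = (\<Sum>v\<in>?V. walk_fps E v) * P"
    using power_sum_fps[of xs] sum_walk_fps[OF V E] len unfolding PE P_def by simp
  ultimately have eq: "(\<Sum>x\<leftarrow>xs. Abs_fps (\<lambda>k. x ^ k)) = (\<Sum>v\<in>?V. walk_fps E v)"
    by simp
  have "(\<Sum>i = 1..n. matching_root n E i ^ k) = (\<Sum>i<n. (l ! i) ^ k)"
    unfolding matching_root_def l_def[symmetric]
    by (rule sum.reindex_bij_witness[of _ Suc "\<lambda>i. i - 1"]) auto
  also have "\<dots> = (\<Sum>x\<leftarrow>l. x ^ k)"
    by (simp add: sum_list_sum_nth lenl lessThan_atLeast0)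
  also have "\<dots> = (\<Sum>x\<leftarrow>xs. x ^ k)"
    using l by (metis mset_map sum_mset_sum_list)
  also have "\<dots> = (\<Sum>x\<leftarrow>xs. Abs_fps (\<lambda>k. x ^ k)) $ k"
    by (induction xs) auto
  also have "\<dots> = (\<Sum>v\<in>?V. walk_fps E v $ k)"
    unfolding eq by (simp add: fps_sum_nth)
  finally show ?thesis .
qed

subsection \<open>Moments of the semicircle law\<close>

text \<open>These are the Catalan numbers at even indices and 0 at odd ones. The recursion mirrors
  that of \<open>walk_fps\<close>; the link to the semicircle is
  \<open>has_integral_semicircle_moment\<close>.\<close>

fun semicircle_moment :: "nat \<Rightarrow> real" where
  "semicircle_moment 0 = 1"
| "semicircle_moment (Suc 0) = 0"
| "semicircle_moment (Suc (Suc k)) = (\<Sum>i\<le>k. semicircle_moment i * semicircle_moment (k - i))"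

lemma semicircle_moment_nonneg: "semicircle_moment k \<ge> 0"
  by (induction k rule: semicircle_moment.induct) (auto intro!: sum_nonneg mult_nonneg_nonneg)

text \<open>The quadratic convolution is traded for a two-term recurrence, which integration by
  parts can match. It comes from a differential equation for the generating function.\<close>

lemma semicircle_moment_linear_recurrence:
  "real (k + 4) * semicircle_moment (k + 2) = 4 * real (k + 1) * semicircle_moment k"
proof -
  define C where "C = Abs_fps semicircle_moment"
  \<comment> \<open>Completing the square in \<open>C = 1 + fps_X\<^sup>2 * (C * C)\<close> makes
    \<open>D\<close> a square root of \<open>1 - 4 * fps_X\<^sup>2\<close>.\<close>
  define D where "D = 1 - 2 * fps_X\<^sup>2 * C"
  have C: "C = 1 + fps_X\<^sup>2 * (C * C)"
  proof (rule fps_ext)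
    fix n
    have "(1 + fps_X\<^sup>2 * (C * C)) $ n =
        (if n = 0 then 1 else 0) + (if n < 2 then 0 else (C * C) $ (n - 2))"
      by (simp add: fps_X_power_mult_nth)
    then show "C $ n = (1 + fps_X\<^sup>2 * (C * C)) $ n"
      by (cases n rule: semicircle_moment.cases)
        (simp_all add: C_def fps_mult_nth atMost_atLeast0)
  qed
  have "D * D = 1 - 4 * fps_X\<^sup>2 * C + 4 * fps_X\<^sup>2 * (fps_X\<^sup>2 * (C * C))"
    by (simp add: D_def algebra_simps power2_eq_square)
  also have "fps_X\<^sup>2 * (C * C) = C - 1"
    using C by (simp add: algebra_simps)
  finally have DD: "D * D = 1 - 4 * fps_X\<^sup>2" by (simp add: algebra_simps)
  have "2 * (D * fps_deriv D) = fps_deriv (D * D)"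
    by (simp add: algebra_simps)
  also have "\<dots> = - 8 * fps_X"
    unfolding DD by (simp add: power2_eq_square algebra_simps)
  finally have "2 * (D * fps_deriv D) = 2 * (- 4 * fps_X)" by simp
  then have "D * fps_deriv D = - 4 * fps_X" by (subst (asm) mult_cancel_left) simp
  then have "(D * D) * fps_deriv D = - 4 * fps_X * D" by (simp add: mult.assoc mult.left_commute)
  then have "fps_deriv D - fps_const 4 * (fps_X\<^sup>2 * fps_deriv D) = - (fps_const 4 * (fps_X * D))"
    unfolding DD by (simp add: algebra_simps flip: numeral_fps_const)
  \<comment> \<open>At this index only the coefficients \<open>k + 4\<close> and
    \<open>k + 2\<close> of \<open>D\<close> occur, which carry the moments \<open>k + 2\<close> and
    \<open>k\<close>.\<close>
  from arg_cong[OF this, of "\<lambda>f. f $ (k + 3)"]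
  have *: "real (k + 4) * D $ (k + 4) - 4 * (real (k + 2) * D $ (k + 2)) = - 4 * D $ (k + 2)"
    by (simp add: power2_eq_square mult.assoc eval_nat_numeral)
  have Dn: "D $ (j + 2) = - 2 * semicircle_moment j" for j
    by (simp add: D_def C_def mult.assoc fps_X_power_mult_nth numeral_fps_const)
  have "k + 4 = (k + 2) + 2" by simp
  then have "D $ (k + 4) = - 2 * semicircle_moment (k + 2)" by (metis Dn)
  with * Dn[of k] show ?thesis
    by (simp add: algebra_simps del: semicircle_moment.simps add_2_eq_Suc')
qed

lemma DERIV_semicircle_cubed:
  assumes "\<bar>x\<bar> < 2"
  shows "((\<lambda>x. (4 - x\<^sup>2) * sqrt (4 - x\<^sup>2)) has_real_derivative - 3 * x * sqrt (4 - x\<^sup>2)) (at x)"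
proof -
  have "x\<^sup>2 < 2\<^sup>2" using power_strict_mono[OF assms, of 2] by simp
  then have pos: "4 - x\<^sup>2 > 0" by simp
  define s where "s = sqrt (4 - x\<^sup>2)"
  have s: "s > 0" "s * s = 4 - x\<^sup>2" using pos by (auto simp: s_def)
  have "((\<lambda>x. (4 - x\<^sup>2) * sqrt (4 - x\<^sup>2)) has_real_derivative
      - 2 * x * s + (4 - x\<^sup>2) * (- 2 * x * (inverse s / 2))) (at x)"
    using pos unfolding s_def by (auto intro!: derivative_eq_intros simp: field_simps)
  also have "- 2 * x * s + (4 - x\<^sup>2) * (- 2 * x * (inverse s / 2)) = - 3 * x * s"
    unfolding s(2)[symmetric] using s(1) by simp
  finally show ?thesis by (simp add: s_def)
qed

text \<open>The integrand is the derivative of \<open>x ^ (k + 1)\<close> times the cube of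
  \<open>sqrt (4 - x\<^sup>2)\<close>, which vanishes at both ends.\<close>

lemma semicircle_recurrence_integral:
  "((\<lambda>x. (4 * real (k + 1) * x ^ k - real (k + 4) * x ^ (k + 2)) * sqrt (4 - x\<^sup>2))
    has_integral 0) {-2..2}"
proof -
  let ?F = "\<lambda>x::real. x ^ (k + 1) * ((4 - x\<^sup>2) * sqrt (4 - x\<^sup>2))"
  let ?f = "\<lambda>x. (4 * real (k + 1) * x ^ k - real (k + 4) * x ^ (k + 2)) * sqrt (4 - x\<^sup>2)"
  have "(?f has_integral (?F 2 - ?F (-2))) {-2..2}"
  proof (rule fundamental_theorem_of_calculus_interior)
    show "continuous_on {-2..2} ?F" by (intro continuous_intros)
    fix x :: real assume "x \<in> {-2<..<2}"
    then have "\<bar>x\<bar> < 2" by auto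
    from DERIV_mult[OF DERIV_pow[of "k + 1" x] DERIV_semicircle_cubed[OF this]]
    have "(?F has_real_derivative ?f x) (at x)"
      by (rule DERIV_cong) (simp add: algebra_simps power2_eq_square)
    then show "(?F has_vector_derivative ?f x) (at x)"
      by (simp add: has_real_derivative_iff_has_vector_derivative)
  qed simp
  then show ?thesis by simp
qed

text \<open>The value is the area of a half-disc of radius 2.\<close>

lemma semicircle_zeroth_integral: "((\<lambda>x. sqrt (4 - x\<^sup>2)) has_integral (2 * pi)) {-2..2}"
proof -
  let ?F = "\<lambda>x::real. x * sqrt (4 - x\<^sup>2) / 2 + 2 * arcsin (x / 2)"
  have "((\<lambda>x. sqrt (4 - x\<^sup>2)) has_integral (?F 2 - ?F (-2))) {-2..2}"
  proof (rule fundamental_theorem_of_calculus_interior)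
    show "continuous_on {-2..2} ?F" by (intro continuous_intros) auto
    fix x :: real assume x: "x \<in> {-2<..<2}"
    then have "x\<^sup>2 < 2\<^sup>2" using power_strict_mono[of "\<bar>x\<bar>" 2 2] by (simp add: abs_less_iff)
    then have pos: "4 - x\<^sup>2 > 0" by simp
    define s where "s = sqrt (4 - x\<^sup>2)"
    have s: "s > 0" "s * s = 4 - x\<^sup>2" using pos by (auto simp: s_def)
    have e: "1 - (x / 2)\<^sup>2 = (4 - x\<^sup>2) / 4" by (simp add: field_simps power2_eq_square)
    have r: "sqrt (1 - (x / 2)\<^sup>2) = s / 2" unfolding e s_def by (simp add: real_sqrt_divide)
    have a: "(arcsin has_real_derivative inverse (s / 2)) (at (x / 2))"
      unfolding r[symmetric] using x by (intro DERIV_arcsin) auto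
    have "((\<lambda>x. x * sqrt (4 - x\<^sup>2) / 2) has_real_derivative
        (s + x * (- 2 * x * (inverse s / 2))) / 2) (at x)"
      using pos unfolding s_def by (auto intro!: derivative_eq_intros simp: field_simps)
    moreover have "((\<lambda>x. 2 * arcsin (x / 2)) has_real_derivative 2 * (inverse (s / 2) * (1 / 2))) (at x)"
      by (intro DERIV_cmult DERIV_chain2[where g = "\<lambda>x. x / 2", OF a])
        (auto intro!: derivative_eq_intros)
    ultimately have "(?F has_real_derivative
        (s + x * (- 2 * x * (inverse s / 2))) / 2 + 2 * (inverse (s / 2) * (1 / 2))) (at x)"
      by (rule DERIV_add)
    also have "(s + x * (- 2 * x * (inverse s / 2))) / 2 + 2 * (inverse (s / 2) * (1 / 2)) = s"
      using s by (simp add: field_simps power2_eq_square)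
    finally show "(?F has_vector_derivative sqrt (4 - x\<^sup>2)) (at x)"
      by (simp add: has_real_derivative_iff_has_vector_derivative s_def)
  qed simp
  then show ?thesis by (simp add: arcsin_minus)
qed

lemma semicircle_first_integral: "((\<lambda>x. x * sqrt (4 - x\<^sup>2)) has_integral 0) {-2..2}"
proof -
  let ?F = "\<lambda>x::real. (4 - x\<^sup>2) * sqrt (4 - x\<^sup>2)"
  have "((\<lambda>x. - 3 * x * sqrt (4 - x\<^sup>2)) has_integral (?F 2 - ?F (-2))) {-2..2}"
    using DERIV_semicircle_cubed
    by (intro fundamental_theorem_of_calculus_interior continuous_intros)
      (auto simp: has_real_derivative_iff_has_vector_derivative abs_less_iff)
  from has_integral_mult_right[OF this, of "- (1 / 3)"] show ?thesis by simp
qed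

lemma has_integral_semicircle_moment:
  "((\<lambda>x. x ^ k * sqrt (4 - x\<^sup>2)) has_integral (2 * pi * semicircle_moment k)) {-2..2}"
proof (induction k rule: semicircle_moment.induct)
  case 1
  then show ?case using semicircle_zeroth_integral by simp
next
  case 2
  then show ?case using semicircle_first_integral by simp
next
  case (3 k)
  \<comment> \<open>The second induction hypothesis is about \<open>k - i\<close>; the choice
    \<open>i = 0\<close> yields index \<open>k\<close>.\<close>
  have IH: "((\<lambda>x. x ^ k * sqrt (4 - x\<^sup>2)) has_integral (2 * pi * semicircle_moment k)) {-2..2}"
    using "3.IH"(2)[of 0] by simp
  \<comment> \<open>The vanishing integral is solved for the term with
    \<open>x ^ (k + 2)\<close>.\<close>
  have "((\<lambda>x. (4 * real (k + 1) * (x ^ k * sqrt (4 - x\<^sup>2)) -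
      (4 * real (k + 1) * x ^ k - real (k + 4) * x ^ (k + 2)) * sqrt (4 - x\<^sup>2)) / real (k + 4))
      has_integral (4 * real (k + 1) * (2 * pi * semicircle_moment k) - 0) / real (k + 4)) {-2..2}"
    by (intro has_integral_divide has_integral_diff has_integral_mult_right IH
        semicircle_recurrence_integral)
  moreover have "(4 * real (k + 1) * (x ^ k * sqrt (4 - x\<^sup>2)) -
      (4 * real (k + 1) * x ^ k - real (k + 4) * x ^ (k + 2)) * sqrt (4 - x\<^sup>2)) / real (k + 4) =
      x ^ Suc (Suc k) * sqrt (4 - x\<^sup>2)" for x :: real
    by (simp add: field_simps)
  moreover have "(4 * real (k + 1) * (2 * pi * semicircle_moment k) - 0) / real (k + 4) =
      2 * pi * semicircle_moment (k + 2)"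
    using semicircle_moment_linear_recurrence[of k] by (simp add: field_simps del: semicircle_moment.simps)
  ultimately show ?case
    by (simp only: add_2_eq_Suc')
qed

subsection \<open>Stieltjes integrals as expectations\<close>

lemma interval_measure_cdf:
  assumes "real_distribution M"
  shows "interval_measure (cdf M) = M"
proof -
  interpret real_distribution M by fact
  show ?thesis
    by (intro cdf_unique real_distribution_interval_measure cdf_interval_measure assms
        cdf_nondecreasing cdf_is_right_cont cdf_lim_at_bot cdf_lim_at_top_prob)
qed

text \<open>The function \<open>root_distribution n p E\<close> is the cdf of the scaled root at a
  uniformly random index.\<close>

lemma stieltjes_integral_root_distribution:
  assumes "n > 0" and f: "f \<in> borel_measurable borel"
  shows "stieltjes_integral (root_distribution n p E) f = (\<Sum>i = 1..n. f (scaled_root n p E i)) / real n"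
    (is "_ = (\<Sum>i = 1..n. f (?X i)) / _")
proof -
  define U where "U = pmf_of_set {1..n}"
  have ne: "{1..n} \<noteq> {}" "finite {1..n}" using assms by auto
  define M where "M = distr U borel ?X"
  have M: "real_distribution M"
    unfolding M_def by (rule prob_space.real_distribution_distr[OF measure_pmf.prob_space_axioms]) simp
  have "cdf M x = root_distribution n p E x" for x
  proof -
    have "cdf M x = measure U (?X -` {..x} \<inter> UNIV)"
      unfolding cdf_def M_def by (subst measure_distr) auto
    also have "\<dots> = real (card ({1..n} \<inter> (?X -` {..x}))) / real n"
      unfolding U_def using measure_pmf_of_set[OF ne] by simp
    also have "{1..n} \<inter> (?X -` {..x}) = {i \<in> {1..n}. ?X i \<le> x}" by auto
    finally show ?thesis by (simp add: root_distribution_def)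
  qed
  then have "root_distribution n p E = cdf M" by auto
  then have "stieltjes_integral (root_distribution n p E) f = (LINT x|M. f x)"
    by (simp add: stieltjes_integral_def interval_measure_cdf[OF M])
  also have "\<dots> = (LINT i|U. f (?X i))"
    unfolding M_def using f by (subst integral_distr) auto
  also have "\<dots> = (\<Sum>i = 1..n. f (?X i)) / real n"
    unfolding U_def using integral_pmf_of_set[OF ne] by simp
  finally show ?thesis .
qed

lemma semicircle_density_integral:
  "integrable lborel (\<lambda>x. semicircle_density x * x ^ k)"
  "(LINT x|lborel. semicircle_density x * x ^ k) = semicircle_moment k"
proof -
  let ?f = "\<lambda>x::real. x ^ k * sqrt (4 - x\<^sup>2)"
  have eq: "semicircle_density x * x ^ k = (1 / (2 * pi)) * (indicator {-2..2} x *\<^sub>R ?f x)" for x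
    by (auto simp: semicircle_density_def indicator_def)
  have int: "set_integrable lborel {-2..2} ?f"
    by (intro borel_integrable_atLeastAtMost' continuous_intros)
  then show "integrable lborel (\<lambda>x. semicircle_density x * x ^ k)"
    unfolding eq set_integrable_def by (rule integrable_mult_right)
  have "(LINT x:{-2..2}|lborel. ?f x) = 2 * pi * semicircle_moment k"
    using set_borel_integral_eq_integral(2)[OF int] has_integral_semicircle_moment[of k]
    by (simp add: integral_unique)
  then show "(LINT x|lborel. semicircle_density x * x ^ k) = semicircle_moment k"
    unfolding eq set_lebesgue_integral_def by simp
qed

lemma semicircle_density_nonneg: "semicircle_density x \<ge> 0"
  by (auto simp: semicircle_density_def abs_le_square_iff[of x 2, simplified])

text \<open>The density defines a probability measure with this cdf; its total mass is the zeroth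
  moment.\<close>

lemma stieltjes_integral_semicircle:
  "stieltjes_integral semicircle_distribution (\<lambda>x. x ^ k) = semicircle_moment k"
proof -
  let ?\<rho> = semicircle_density
  have \<rho>: "?\<rho> \<in> borel_measurable borel"
    unfolding semicircle_density_def by measurable
  define M where "M = density lborel (\<lambda>x. ennreal (?\<rho> x))"
  have int_M: "(LINT x|M. f x) = (LINT x|lborel. ?\<rho> x * f x)"
    if "f \<in> borel_measurable borel" for f :: "real \<Rightarrow> real"
    unfolding M_def using that \<rho>
    by (subst integral_density) (auto simp: semicircle_density_nonneg)
  have "emeasure M (space M) = (\<integral>\<^sup>+x. ennreal (?\<rho> x) \<partial>lborel)"
    using \<rho> by (simp add: M_def emeasure_density)
  also have "\<dots> = ennreal (LINT x|lborel. ?\<rho> x)"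
    using semicircle_density_integral(1)[of 0]
    by (intro nn_integral_eq_integral) (auto simp: semicircle_density_nonneg)
  also have "\<dots> = 1" using semicircle_density_integral(2)[of 0] by simp
  finally have "prob_space M" by (rule prob_spaceI)
  then have M: "real_distribution M"
    by (simp add: real_distribution_def real_distribution_axioms_def M_def)
  interpret prob_space M by fact
  have "cdf M x = semicircle_distribution x" for x
  proof -
    have "cdf M x = (LINT t|M. indicator {..x} t)"
      unfolding cdf_def by (subst Bochner_Integration.integral_indicator) (simp_all add: M_def)
    also have "\<dots> = semicircle_distribution x"
      by (subst int_M) (simp_all add: semicircle_distribution_def set_lebesgue_integral_def mult.commute)
    finally show ?thesis .
  qed
  then have eq: "semicircle_distribution = cdf M" by auto
  have "stieltjes_integral semicircle_distribution (\<lambda>x. x ^ k) = (LINT x|M. x ^ k)"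
    unfolding stieltjes_integral_def eq interval_measure_cdf[OF M] ..
  also have "\<dots> = semicircle_moment k"
    by (subst int_M) (simp_all add: semicircle_density_integral(2))
  finally show ?thesis .
qed

subsection \<open>Degree bounds for the moments\<close>

lemma walk_fps_nonneg:
  assumes "finite V" "E \<subseteq> all_edges V"
  shows "walk_fps E v $ j \<ge> 0"
  using assms
proof (induction j arbitrary: V E v rule: less_induct)
  case (less j)
  note D = finite_Diff[OF less.prems(1)] delete_vertex_all_edges[OF less.prems(2)]
  show ?case
  proof (cases j rule: semicircle_moment.cases)
    case (3 k)
    then show ?thesis
      using walk_fps_nth(3)[OF less.prems, of v k] less.IH[OF _ less.prems] less.IH[OF _ D]
      by (auto intro!: sum_nonneg mult_nonneg_nonneg)
  qed (use walk_fps_nth(1,2)[OF less.prems, of v] in auto)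
qed

lemma neighbours_delete_vertex:
  "u \<noteq> v \<Longrightarrow> neighbours (delete_vertex E v) u = neighbours E u - {v}"
  by (auto simp: neighbours_def delete_vertex_def)

text \<open>The comparison sequence obeys the walk recurrence with exactly \<open>d\<close>
  neighbours everywhere. For integer \<open>d\<close> it counts closed walks from the root of the
  infinite \<open>d\<close>-ary tree.\<close>

lemma semicircle_moment_scaled:
  assumes "d \<ge> 0"
  shows "semicircle_moment (Suc (Suc k)) * sqrt d ^ Suc (Suc k) =
    d * (\<Sum>i\<le>k. (semicircle_moment i * sqrt d ^ i) * (semicircle_moment (k - i) * sqrt d ^ (k - i)))"
proof -
  have "(\<Sum>i\<le>k. (semicircle_moment i * sqrt d ^ i) * (semicircle_moment (k - i) * sqrt d ^ (k - i))) =
      (\<Sum>i\<le>k. semicircle_moment i * semicircle_moment (k - i) * sqrt d ^ k)"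
  proof (rule sum.cong[OF refl])
    fix i assume "i \<in> {..k}"
    then have "sqrt d ^ k = sqrt d ^ i * sqrt d ^ (k - i)" by (simp flip: power_add)
    then show "(semicircle_moment i * sqrt d ^ i) * (semicircle_moment (k - i) * sqrt d ^ (k - i)) =
        semicircle_moment i * semicircle_moment (k - i) * sqrt d ^ k"
      by (simp only: mult_ac)
  qed
  then have "(\<Sum>i\<le>k. (semicircle_moment i * sqrt d ^ i) * (semicircle_moment (k - i) * sqrt d ^ (k - i))) =
      semicircle_moment (Suc (Suc k)) * sqrt d ^ k"
    by (simp add: sum_distrib_right)
  moreover have "sqrt d ^ Suc (Suc k) = d * sqrt d ^ k"
    using assms by simp
  ultimately show ?thesis by (simp only: mult_ac)
qed

text \<open>Deleting a vertex never raises a degree, so the bound \<open>d\<close> passes to every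
  graph met in the recursion.\<close>

lemma walk_fps_upper_bound:
  assumes "finite V" "E \<subseteq> all_edges V" "\<And>u. real (card (neighbours E u)) \<le> d"
  shows "walk_fps E v $ j \<le> semicircle_moment j * sqrt d ^ j"
  using assms
proof (induction j arbitrary: V E v rule: less_induct)
  case (less j)
  let ?D = "delete_vertex E v"
  note D = finite_Diff[OF less.prems(1)] delete_vertex_all_edges[OF less.prems(2), of v]
  have d: "d \<ge> 0" using less.prems(3)[of v] by simp
  have degD: "real (card (neighbours ?D u)) \<le> d" for u
  proof -
    have "card (neighbours ?D u) \<le> card (neighbours E u)"
      by (intro card_mono finite_neighbours[OF less.prems(1,2)])
        (auto simp: neighbours_def delete_vertex_def)
    with less.prems(3)[of u] show ?thesis by linarith
  qed
  show ?case
  proof (cases j rule: semicircle_moment.cases)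
    case (3 k)
    let ?S = "\<Sum>i\<le>k. (semicircle_moment i * sqrt d ^ i) * (semicircle_moment (k - i) * sqrt d ^ (k - i))"
    have pos: "?S \<ge> 0"
      using d by (auto intro!: sum_nonneg mult_nonneg_nonneg semicircle_moment_nonneg)
    have "walk_fps E v $ j = (\<Sum>u\<in>neighbours E v. \<Sum>i\<le>k. walk_fps ?D u $ i * walk_fps E v $ (k - i))"
      using walk_fps_nth(3)[OF less.prems(1,2), of v k] 3 by simp
    also have "\<dots> \<le> (\<Sum>u\<in>neighbours E v. ?S)"
      using 3 d
      by (intro sum_mono mult_mono less.IH[OF _ less.prems] less.IH[OF _ D degD]
          walk_fps_nonneg[OF less.prems(1,2)] mult_nonneg_nonneg semicircle_moment_nonneg) auto
    also have "\<dots> = real (card (neighbours E v)) * ?S" by simp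
    also have "\<dots> \<le> d * ?S" using less.prems(3) pos by (intro mult_right_mono)
    finally show ?thesis unfolding 3 semicircle_moment_scaled[OF d] .
  qed (use walk_fps_nth(1,2)[OF less.prems(1,2), of v] in auto)
qed

text \<open>A deletion costs each remaining vertex at most one neighbour, while the index drops by
  at least two; the surplus \<open>real j\<close> in the degrees pays for this.\<close>

lemma walk_fps_lower_bound:
  assumes "finite V" "E \<subseteq> all_edges V" "m \<ge> 0"
    "\<And>u. u \<in> V \<Longrightarrow> real (card (neighbours E u)) \<ge> m + real j" "v \<in> V"
  shows "walk_fps E v $ j \<ge> semicircle_moment j * sqrt m ^ j"
  using assms(1,2,4,5)
proof (induction j arbitrary: V E v rule: less_induct)
  case (less j)
  let ?D = "delete_vertex E v"
  note m = \<open>m \<ge> 0\<close>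
  note D = finite_Diff[OF less.prems(1)] delete_vertex_all_edges[OF less.prems(2), of v]
  show ?case
  proof (cases j rule: semicircle_moment.cases)
    case (3 k)
    have degE: "m + real i \<le> real (card (neighbours E u))" if "u \<in> V" "i \<le> k" for u i
      using less.prems(3)[OF that(1)] that(2) 3 by simp
    \<comment> \<open>Here \<open>i \<le> k\<close> and \<open>j = k + 2\<close>, so one lost
      neighbour still leaves degree at least \<open>m + real i\<close>.\<close>
    have degD: "m + real i \<le> real (card (neighbours ?D u))" if "u \<in> V - {v}" "i \<le> k" for u i
    proof -
      have "card (neighbours E u) - 1 \<le> card (neighbours ?D u)"
        using that diff_card_le_card_Diff[of "{v}" "neighbours E u"] by (simp add: neighbours_delete_vertex)
      with less.prems(3)[of u] that 3 show ?thesis by simp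
    qed
    let ?S = "\<Sum>i\<le>k. (semicircle_moment i * sqrt m ^ i) * (semicircle_moment (k - i) * sqrt m ^ (k - i))"
    have pos: "?S \<ge> 0"
      using m by (auto intro!: sum_nonneg mult_nonneg_nonneg semicircle_moment_nonneg)
    have "m * ?S \<le> real (card (neighbours E v)) * ?S"
      using degE[OF less.prems(4), of 0] pos by (intro mult_right_mono) auto
    also have "\<dots> = (\<Sum>u\<in>neighbours E v. ?S)" by simp
    also have "\<dots> \<le> (\<Sum>u\<in>neighbours E v. \<Sum>i\<le>k. walk_fps ?D u $ i * walk_fps E v $ (k - i))"
    proof (intro sum_mono mult_mono)
      fix u i assume u: "u \<in> neighbours E v" and i: "i \<in> {..k}"
      have uV: "u \<in> V - {v}" using u neighbours_subset[OF less.prems(2)] by blast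
      show "semicircle_moment i * sqrt m ^ i \<le> walk_fps ?D u $ i"
        using 3 i uV by (intro less.IH[OF _ D] degD) auto
      show "semicircle_moment (k - i) * sqrt m ^ (k - i) \<le> walk_fps E v $ (k - i)"
        using 3 i less.prems(4) by (intro less.IH[OF _ less.prems(1,2)] degE) auto
      show "0 \<le> walk_fps ?D u $ i" by (rule walk_fps_nonneg[OF D])
      show "0 \<le> semicircle_moment (k - i) * sqrt m ^ (k - i)"
        using m semicircle_moment_nonneg by simp
    qed
    also have "\<dots> = walk_fps E v $ j"
      using walk_fps_nth(3)[OF less.prems(1,2), of v k] 3 by simp
    finally show ?thesis unfolding 3 semicircle_moment_scaled[OF m] .
  qed (use walk_fps_nth(1,2)[OF less.prems(1,2), of v] in auto)
qed

subsection \<open>Degrees in the random graph\<close>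

lemma set_pmf_erdos_renyi: "E \<in> set_pmf (erdos_renyi n p) \<Longrightarrow> E \<subseteq> all_edges {1..n}"
  by (auto simp: erdos_renyi_def)

lemma finite_set_pmf_erdos_renyi: "finite (set_pmf (erdos_renyi n p))"
proof (rule finite_subset)
  show "set_pmf (erdos_renyi n p) \<subseteq> Pow (all_edges {1..n})"
    by (intro subsetI PowI set_pmf_erdos_renyi)
qed (simp add: finite_all_edges)

text \<open>The degree counts successes among the \<open>n - 1\<close> independent potential edges
  at \<open>v\<close>, collected in \<open>B\<close>.\<close>

lemma degree_distribution_erdos_renyi:
  assumes p: "p \<in> {0..1}" and v: "v \<in> {1..n}"
  shows "map_pmf (\<lambda>E. card (neighbours E v)) (erdos_renyi n p) = binomial_pmf (n - 1) p"
proof -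
  let ?A = "all_edges {1..n}"
  define B where "B = (\<lambda>u. {u, v}) ` ({1..n} - {v})"
  have inj: "inj_on (\<lambda>u. {u, v}) S" for S by (auto simp: inj_on_def doubleton_eq_iff)
  have B: "finite B" "card B = n - 1"
    using v by (simp_all add: B_def card_image[OF inj])
  have BA: "B \<subseteq> ?A" using v by (auto simp: B_def all_edges_def)
  have nb: "card (neighbours {e \<in> ?A. f e} v) = card {e \<in> B. f e}" for f
  proof -
    have "(\<lambda>u. {u, v}) ` neighbours {e \<in> ?A. f e} v = {e \<in> B. f e}"
    proof
      show "(\<lambda>u. {u, v}) ` neighbours {e \<in> ?A. f e} v \<subseteq> {e \<in> B. f e}"
        using neighbours_subset[of "{e \<in> ?A. f e}" "{1..n}" v]
        by (auto simp: neighbours_def B_def)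
      show "{e \<in> B. f e} \<subseteq> (\<lambda>u. {u, v}) ` neighbours {e \<in> ?A. f e} v"
        using BA by (auto simp: neighbours_def B_def)
    qed
    then show ?thesis using card_image[OF inj] by metis
  qed
  have "binomial_pmf (n - 1) p =
      map_pmf (\<lambda>f. card {e \<in> B. f e}) (Pi_pmf B False (\<lambda>_. bernoulli_pmf p))"
    by (rule binomial_pmf_altdef'[OF B p])
  \<comment> \<open>The count ignores edges outside \<open>B\<close>, so the product over
    \<open>B\<close> may be replaced by the one over all edges.\<close>
  also have "\<dots> = map_pmf (\<lambda>f. card {e \<in> B. f e}) (Pi_pmf ?A False (\<lambda>_. bernoulli_pmf p))"
  proof -
    have "{e \<in> B. if e \<in> B then f e else False} = {e \<in> B. f e}" for f by auto
    then show ?thesis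
      by (subst Pi_pmf_subset[OF finite_all_edges BA]) (simp_all add: pmf.map_comp o_def)
  qed
  also have "\<dots> = map_pmf (\<lambda>E. card (neighbours E v)) (erdos_renyi n p)"
    unfolding erdos_renyi_def pmf.map_comp o_def nb ..
  finally show ?thesis ..
qed

text \<open>Hoeffding's inequality for each binomial degree, followed by a union bound over the
  vertices.\<close>

lemma prob_degree_deviation:
  assumes p: "p \<in> {0..1}" and n: "n \<ge> 2" and eps: "\<epsilon> \<ge> 0"
  shows "measure_pmf.prob (erdos_renyi n p)
      {E. \<exists>v\<in>{1..n}. \<bar>real (card (neighbours E v)) - real (n - 1) * p\<bar> \<ge> \<epsilon>}
    \<le> real n * (2 * exp (- 2 * \<epsilon>\<^sup>2 / real n))"
proof -
  let ?P = "measure_pmf.prob (erdos_renyi n p)"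
  let ?S = "\<lambda>v. {E. \<bar>real (card (neighbours E v)) - real (n - 1) * p\<bar> \<ge> \<epsilon>}"
  interpret binomial_distribution "n - 1" p by standard (fact p)
  have "?P (?S v) \<le> 2 * exp (- 2 * \<epsilon>\<^sup>2 / real n)" if v: "v \<in> {1..n}" for v
  proof -
    have "?P (?S v) = measure_pmf.prob (map_pmf (\<lambda>E. card (neighbours E v)) (erdos_renyi n p))
        {x. \<bar>real x - real (n - 1) * p\<bar> \<ge> \<epsilon>}"
      by (simp add: vimage_def)
    also have "\<dots> \<le> 2 * exp (- 2 * \<epsilon>\<^sup>2 / real (n - 1))"
      unfolding degree_distribution_erdos_renyi[OF p v] using n eps by (intro prob_abs_ge) auto
    also have "\<dots> \<le> 2 * exp (- 2 * \<epsilon>\<^sup>2 / real n)"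
      using n by (simp add: frac_le)
    finally show ?thesis .
  qed
  then have "(\<Sum>v\<in>{1..n}. ?P (?S v)) \<le> real n * (2 * exp (- 2 * \<epsilon>\<^sup>2 / real n))"
    using sum_bounded_above[of "{1..n}" "\<lambda>v. ?P (?S v)"] by simp
  moreover have "?P (\<Union>v\<in>{1..n}. ?S v) \<le> (\<Sum>v\<in>{1..n}. ?P (?S v))"
    by (rule measure_pmf.finite_measure_subadditive_finite) auto
  moreover have "(\<Union>v\<in>{1..n}. ?S v) =
      {E. \<exists>v\<in>{1..n}. \<bar>real (card (neighbours E v)) - real (n - 1) * p\<bar> \<ge> \<epsilon>}" by auto
  ultimately show ?thesis by simp
qed

subsection \<open>Convergence of the moments\<close>

lemma stieltjes_integral_root_distribution_power:
  assumes n: "n > 0" and E: "E \<subseteq> all_edges {1..n}"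
  shows "stieltjes_integral (root_distribution n p E) (\<lambda>x. x ^ k) =
    (\<Sum>v = 1..n. walk_fps E v $ k) / real n / sqrt (real n * p) ^ k"
proof -
  have "stieltjes_integral (root_distribution n p E) (\<lambda>x. x ^ k) =
      (\<Sum>i = 1..n. scaled_root n p E i ^ k) / real n"
    by (rule stieltjes_integral_root_distribution[OF n]) simp
  also have "(\<Sum>i = 1..n. scaled_root n p E i ^ k) =
      (\<Sum>i = 1..n. matching_root n E i ^ k) / sqrt (real n * p) ^ k"
    by (simp add: scaled_root_def power_divide sum_divide_distrib)
  finally show ?thesis unfolding sum_matching_root_power[OF E] by simp
qed

lemma root_moment_upper_bound:
  assumes n: "n > 0" and E: "E \<subseteq> all_edges {1..n}" and "p > 0" and d: "d \<ge> 0"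
    and deg: "\<And>v. v \<in> {1..n} \<Longrightarrow> real (card (neighbours E v)) \<le> d"
  shows "stieltjes_integral (root_distribution n p E) (\<lambda>x. x ^ k)
    \<le> semicircle_moment k * (sqrt d / sqrt (real n * p)) ^ k"
proof -
  \<comment> \<open>The walk bound asks for all vertices of the type; those outside the graph have
    no neighbours.\<close>
  have deg': "real (card (neighbours E v)) \<le> d" for v
  proof (cases "v \<in> {1..n}")
    case False
    then have "neighbours E v = {}"
      using E by (auto simp: neighbours_def all_edges_def)
    then show ?thesis using d by simp
  qed (rule deg)
  have "(\<Sum>v = 1..n. walk_fps E v $ k) \<le> (\<Sum>v = 1..n. semicircle_moment k * sqrt d ^ k)"
    by (intro sum_mono walk_fps_upper_bound[OF _ E deg']) simp
  then have "(\<Sum>v = 1..n. walk_fps E v $ k) / real n \<le> semicircle_moment k * sqrt d ^ k"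
    using n by (simp add: field_simps)
  then show ?thesis
    unfolding stieltjes_integral_root_distribution_power[OF n E] power_divide times_divide_eq_right
    using \<open>p > 0\<close> by (intro divide_right_mono) auto
qed

lemma root_moment_lower_bound:
  assumes n: "n > 0" and E: "E \<subseteq> all_edges {1..n}" and "p > 0" and m: "m \<ge> 0"
    and deg: "\<And>v. v \<in> {1..n} \<Longrightarrow> real (card (neighbours E v)) \<ge> m + real k"
  shows "stieltjes_integral (root_distribution n p E) (\<lambda>x. x ^ k)
    \<ge> semicircle_moment k * (sqrt m / sqrt (real n * p)) ^ k"
proof -
  have "(\<Sum>v = 1..n. walk_fps E v $ k) \<ge> (\<Sum>v = 1..n. semicircle_moment k * sqrt m ^ k)"
    by (intro sum_mono walk_fps_lower_bound[OF _ E m deg]) simp_all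
  then have "(\<Sum>v = 1..n. walk_fps E v $ k) / real n \<ge> semicircle_moment k * sqrt m ^ k"
    using n by (simp add: field_simps)
  then show ?thesis
    unfolding stieltjes_integral_root_distribution_power[OF n E] power_divide times_divide_eq_right
    using \<open>p > 0\<close> by (intro divide_right_mono) auto
qed

lemma root_moment_nonneg:
  assumes n: "n > 0" and E: "E \<subseteq> all_edges {1..n}" and "p > 0"
  shows "stieltjes_integral (root_distribution n p E) (\<lambda>x. x ^ k) \<ge> 0"
  unfolding stieltjes_integral_root_distribution_power[OF n E]
  using \<open>p > 0\<close> by (intro divide_nonneg_nonneg sum_nonneg walk_fps_nonneg[OF _ E]) auto

text \<open>Degrees never exceed \<open>n\<close>, which gives a bound independent of
  \<open>n\<close> for use on the exceptional event.\<close>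

lemma root_moment_trivial_bound:
  assumes n: "n > 0" and E: "E \<subseteq> all_edges {1..n}" and "p > 0"
  shows "stieltjes_integral (root_distribution n p E) (\<lambda>x. x ^ k) \<le> semicircle_moment k / sqrt p ^ k"
proof -
  have "real (card (neighbours E v)) \<le> real n" for v
    using card_mono[OF _ neighbours_subset[OF E, of v]] card_Diff1_le[of "{1..n}" v] by simp
  then have "stieltjes_integral (root_distribution n p E) (\<lambda>x. x ^ k)
      \<le> semicircle_moment k * (sqrt (real n) / sqrt (real n * p)) ^ k"
    by (intro root_moment_upper_bound[OF n E \<open>p > 0\<close>]) auto
  then show ?thesis using n by (simp add: real_sqrt_mult power_divide)
qed

text \<open>The expectation is split along the event of a large degree deviation: off it the degree
  bounds apply, on it the moment lies between 0 and the trivial bound.\<close>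

lemma expected_root_moment_bounds:
  fixes n k :: nat
  assumes n: "n \<ge> 2" and p: "0 < p" "p < 1" and \<epsilon>: "\<epsilon> \<ge> 0" and m: "real n * p - 1 - \<epsilon> - real k \<ge> 0"
  defines "L \<equiv> semicircle_moment k * (sqrt (real n * p - 1 - \<epsilon> - real k) / sqrt (real n * p)) ^ k"
    and "U \<equiv> semicircle_moment k * (sqrt (real n * p + \<epsilon>) / sqrt (real n * p)) ^ k"
    and "q \<equiv> real n * (2 * exp (- 2 * \<epsilon>\<^sup>2 / real n))"
    and "X \<equiv> measure_pmf.expectation (erdos_renyi n p)
        (\<lambda>E. stieltjes_integral (root_distribution n p E) (\<lambda>x. x ^ k))"
  shows "L - L * q \<le> X" and "X \<le> U + semicircle_moment k / sqrt p ^ k * q"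
proof -
  let ?M = "measure_pmf (erdos_renyi n p)"
  let ?f = "\<lambda>E. stieltjes_integral (root_distribution n p E) (\<lambda>x. x ^ k)"
  define B where "B = {E. \<exists>v\<in>{1..n}. \<bar>real (card (neighbours E v)) - real (n - 1) * p\<bar> \<ge> \<epsilon>}"
  define K where "K = semicircle_moment k / sqrt p ^ k"
  have n0: "n > 0" using n by simp
  have B: "measure ?M B \<le> q"
    unfolding B_def q_def using n p \<epsilon> by (intro prob_degree_deviation) auto
  have pos: "0 \<le> K" "0 \<le> L" "0 \<le> U"
    unfolding K_def L_def U_def using p m \<epsilon>
    by (auto intro!: mult_nonneg_nonneg divide_nonneg_nonneg semicircle_moment_nonneg)
  have int: "integrable ?M g" for g :: "nat set set \<Rightarrow> real"
    by (rule integrable_measure_pmf_finite[OF finite_set_pmf_erdos_renyi])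
  have good: "L \<le> ?f E \<and> ?f E \<le> U" if E: "E \<subseteq> all_edges {1..n}" and "E \<notin> B" for E
  proof -
    \<comment> \<open>The mean degree is \<open>real n * p - p\<close> with
      \<open>0 < p < 1\<close>; hence the summand \<open>- 1\<close> in \<open>L\<close> and none in
      \<open>U\<close>.\<close>
    have np: "real (n - 1) * p = real n * p - p" using n by (simp add: of_nat_diff algebra_simps)
    have deg: "\<bar>real (card (neighbours E v)) - (real n * p - p)\<bar> < \<epsilon>" if "v \<in> {1..n}" for v
      using \<open>E \<notin> B\<close> that unfolding B_def np by force
    have "L \<le> ?f E"
      unfolding L_def by (rule root_moment_lower_bound[OF n0 E p(1) m]) (use deg p in fastforce)
    moreover have "?f E \<le> U"
      unfolding U_def
      by (rule root_moment_upper_bound[OF n0 E p(1)]) (use deg p \<epsilon> in fastforce)+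
    ultimately show ?thesis ..
  qed
  have AE: "AE E in ?M. P E" if "\<And>E. E \<subseteq> all_edges {1..n} \<Longrightarrow> P E" for P
    using that set_pmf_erdos_renyi by (auto simp: AE_measure_pmf_iff)
  have "L - L * q \<le> L - L * measure ?M B"
    using B pos by (simp add: mult_left_mono)
  also have "\<dots> = measure_pmf.expectation (erdos_renyi n p) (\<lambda>E. L - L * indicator B E)"
    by (simp add: int)
  also have "\<dots> \<le> X"
    unfolding X_def
  proof (intro integral_mono_AE int AE)
    fix E assume E: "E \<subseteq> all_edges {1..n}"
    show "L - L * indicator B E \<le> ?f E"
      using good[OF E] root_moment_nonneg[OF n0 E p(1)] by (cases "E \<in> B") auto
  qed
  finally show "L - L * q \<le> X" .
  have "X \<le> measure_pmf.expectation (erdos_renyi n p) (\<lambda>E. U + K * indicator B E)"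
    unfolding X_def
  proof (intro integral_mono_AE int AE)
    fix E assume E: "E \<subseteq> all_edges {1..n}"
    show "?f E \<le> U + K * indicator B E"
      using good[OF E] root_moment_trivial_bound[OF n0 E p(1), of k] pos
      by (cases "E \<in> B") (auto simp: K_def)
  qed
  also have "\<dots> = U + K * measure ?M B"
    by (simp add: int)
  also have "\<dots> \<le> U + K * q"
    using B pos by (simp add: mult_left_mono)
  finally show "X \<le> U + semicircle_moment k / sqrt p ^ k * q" by (simp add: K_def)
qed

theorem theorem3p2:
  fixes p :: real and k :: nat
  assumes "0 < p" and "p < 1" and "k > 0"
  shows "(\<lambda>n. measure_pmf.expectation (erdos_renyi n p)
              (\<lambda>E. stieltjes_integral (root_distribution n p E) (\<lambda>x. x ^ k)))
           \<longlonglongrightarrow> stieltjes_integral semicircle_distribution (\<lambda>x. x ^ k)"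
proof -
  let ?c = "semicircle_moment k"
  \<comment> \<open>The exponent lies strictly between 1/2 and 1: the deviation is negligible
    against \<open>n\<close>, yet its square over \<open>n\<close> is the square root of
    \<open>n\<close>, so the exponential beats the factor \<open>n\<close> of the union
    bound.\<close>
  define \<epsilon> where "\<epsilon> n = real n powr (3/4)" for n
  define q where "q n = real n * (2 * exp (- 2 * (\<epsilon> n)\<^sup>2 / real n))" for n
  define L where "L n = ?c * (sqrt (real n * p - 1 - \<epsilon> n - real k) / sqrt (real n * p)) ^ k" for n
  define U where "U n = ?c * (sqrt (real n * p + \<epsilon> n) / sqrt (real n * p)) ^ k" for n
  have "q \<longlonglongrightarrow> 0"
    unfolding q_def \<epsilon>_def by real_asymp
  have "(\<lambda>n. sqrt (real n * p - 1 - \<epsilon> n - real k) / sqrt (real n * p)) \<longlonglongrightarrow> 1"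
    unfolding \<epsilon>_def using assms(1) by real_asymp
  then have "L \<longlonglongrightarrow> ?c * 1 ^ k"
    unfolding L_def by (intro tendsto_intros)
  have "(\<lambda>n. sqrt (real n * p + \<epsilon> n) / sqrt (real n * p)) \<longlonglongrightarrow> 1"
    unfolding \<epsilon>_def using assms(1) by real_asymp
  then have "U \<longlonglongrightarrow> ?c * 1 ^ k"
    unfolding U_def by (intro tendsto_intros)
  have "\<forall>\<^sub>F n in sequentially. real n * p - 1 - \<epsilon> n - real k \<ge> 0"
    unfolding \<epsilon>_def using assms(1) by real_asymp
  then have ev: "\<forall>\<^sub>F n in sequentially. n \<ge> 2 \<and> \<epsilon> n \<ge> 0 \<and> real n * p - 1 - \<epsilon> n - real k \<ge> 0"
    by (auto simp: \<epsilon>_def intro: eventually_conj eventually_ge_at_top)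
  have "(\<lambda>n. measure_pmf.expectation (erdos_renyi n p)
      (\<lambda>E. stieltjes_integral (root_distribution n p E) (\<lambda>x. x ^ k))) \<longlonglongrightarrow> ?c"
  proof (rule tendsto_sandwich)
    show "(\<lambda>n. L n - L n * q n) \<longlonglongrightarrow> ?c"
      using tendsto_diff[OF \<open>L \<longlonglongrightarrow> _\<close> tendsto_mult[OF \<open>L \<longlonglongrightarrow> _\<close> \<open>q \<longlonglongrightarrow> 0\<close>]] by simp
    show "(\<lambda>n. U n + ?c / sqrt p ^ k * q n) \<longlonglongrightarrow> ?c"
      using tendsto_add[OF \<open>U \<longlonglongrightarrow> _\<close> tendsto_mult_left[OF \<open>q \<longlonglongrightarrow> 0\<close>, of "?c / sqrt p ^ k"]]
      by simp
    show "\<forall>\<^sub>F n in sequentially. L n - L n * q n \<le> measure_pmf.expectation (erdos_renyi n p)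
        (\<lambda>E. stieltjes_integral (root_distribution n p E) (\<lambda>x. x ^ k))"
      using ev unfolding L_def q_def
      by eventually_elim (intro expected_root_moment_bounds(1) assms; simp)
    show "\<forall>\<^sub>F n in sequentially. measure_pmf.expectation (erdos_renyi n p)
        (\<lambda>E. stieltjes_integral (root_distribution n p E) (\<lambda>x. x ^ k)) \<le> U n + ?c / sqrt p ^ k * q n"
      using ev unfolding U_def q_def
      by eventually_elim (intro expected_root_moment_bounds(2) assms; simp)
  qed
  then show ?thesis by (simp only: stieltjes_integral_semicircle)
qed

end
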